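(* Let $n\ge1$, let $v$ be a simple walk of length $n$ and let $k\in[1,n]$. If $v(n)\ge0$ then $(v,k)$ is a quantile pair if and only if it is a Vervaat pair. If $v(n)<0$, then $(v,k)$ is a quantile pair if and only if $(v,k-1)$ is a Vervaat pair. In particular, regardless of $v(n)$, $$\#\{w: V(w)=v\}=\#\{w: Q(w)=v\},$$ where $w$ ranges over simple walks of length $n$.
   Context: Intervals $[a,b]$, $[a,b)$ denote intervals of integers. A simple walk of length $n$ is a function $w:[0,n]\to\mathbb Z$ with $w(0)=0$ and $x_i:=w(i)-w(i-1)\in\{+1,-1\}$ for $i\in[1,n]$. Quantile transform: $\phi_w$ is the unique permutation of $[1,n]$ such that $(w(\phi_w(1)-1),\phi_w(1)-1),\dots,(w(\phi_w(n)-1),\phi_w(n)-1)$ is the increasing lexicographic reordering of $(w(0),0),\dots,(w(n-1),n-1)$, and $Q(w)(j)=\sum_{i=1}^jx_{\phi_w(i)}$, $j\in[0,n]$. Vervaat transform: $\tau_V(w)=\min\{j\in[0,n]: w(j)\le w(i)\text{ for all }i\in[0,n]\}$; $\psi_w$ is the cyclic permutation $i\mapsto i+\tau_V(w)\bmod n$ of $[1,n]$, with representatives modulo $n$ taken in $[1,n]$; $V(w)(j)=\sum_{i=1}^jx_{\psi_w(i)}$, $j\in[0,n]$. A quantile walk is a simple walk $v$ of length $n$ that is either non-negative at all times in $[0,n]$ or a first-passage bridge to a negative value ($v(n)<0$ and $v(j)\ne v(n)$ for $j<n$). A quantile pair is a pair $(v,k)$ with $v$ a quantile walk of length $n$ and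 $k$ an integer, $1\le k\le n$, such that $v(j)\ge0$ for $j\in[0,k)$ and $v(j)>v(n)$ for $j\in[k,n)$. A Vervaat pair is a pair $(v,k)$ with $v$ a simple walk of length $n$ and $k$ an integer, $0\le k\le n$, such that $v(j)\ge0$ for $0\le j\le k$ and $v(j)>v(n)$ for $k\le j<n$. *)

theory Defs
  imports Main "HOL-Library.FuncSet" "HOL-Library.Product_Lexorder"
    "HOL-Combinatorics.Permutations"
begin

(* A function on [0,n] is an extensional function on {0..n}, so that walks which agree on [0,n]
   are equal and sets of walks can be counted. *)
definition simple_walks :: "nat \<Rightarrow> (nat \<Rightarrow> int) set" where
  "simple_walks n =
    {w \<in> {0..n} \<rightarrow>\<^sub>E UNIV. w 0 = 0 \<and> (\<forall>i\<in>{1..n}. w i - w (i - 1) \<in> {1, -1})}"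

definition increment :: "(nat \<Rightarrow> int) \<Rightarrow> nat \<Rightarrow> int" where
  "increment w i = w i - w (i - 1)"

(* The order on pairs is the lexicographic one of Product_Lexorder; permutations of [1,n] are the
   identity outside {1..n}, so the description is indeed definite, as shown by
   is_quantile_perm_unique below. *)
definition is_quantile_perm :: "nat \<Rightarrow> (nat \<Rightarrow> int) \<Rightarrow> (nat \<Rightarrow> nat) \<Rightarrow> bool" where
  "is_quantile_perm n w \<phi> \<longleftrightarrow>
    \<phi> permutes {1..n} \<and> strict_mono_on {1..n} (\<lambda>i. (w (\<phi> i - 1), \<phi> i - 1))"

definition quantile_perm :: "nat \<Rightarrow> (nat \<Rightarrow> int) \<Rightarrow> nat \<Rightarrow> nat" where
  "quantile_perm n w = (THE \<phi>. is_quantile_perm n w \<phi>)"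

definition quantile_transform :: "nat \<Rightarrow> (nat \<Rightarrow> int) \<Rightarrow> nat \<Rightarrow> int" where
  "quantile_transform n w = (\<lambda>j\<in>{0..n}. \<Sum>i=1..j. increment w (quantile_perm n w i))"

definition vervaat_time :: "nat \<Rightarrow> (nat \<Rightarrow> int) \<Rightarrow> nat" where
  "vervaat_time n w = Min {j\<in>{0..n}. \<forall>i\<in>{0..n}. w j \<le> w i}"

(* (m - 1) mod n + 1 is the representative in [1,n] of m modulo n, for m, n \<ge> 1. *)
definition vervaat_perm :: "nat \<Rightarrow> (nat \<Rightarrow> int) \<Rightarrow> nat \<Rightarrow> nat" where
  "vervaat_perm n w i =
    (if i \<in> {1..n} then (i + vervaat_time n w - 1) mod n + 1 else i)"

definition vervaat_transform :: "nat \<Rightarrow> (nat \<Rightarrow> int) \<Rightarrow> nat \<Rightarrow> int" where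
  "vervaat_transform n w = (\<lambda>j\<in>{0..n}. \<Sum>i=1..j. increment w (vervaat_perm n w i))"

definition first_passage_bridge_neg :: "nat \<Rightarrow> (nat \<Rightarrow> int) \<Rightarrow> bool" where
  "first_passage_bridge_neg n v \<longleftrightarrow> v n < 0 \<and> (\<forall>j\<in>{0..<n}. v j \<noteq> v n)"

definition quantile_walk :: "nat \<Rightarrow> (nat \<Rightarrow> int) \<Rightarrow> bool" where
  "quantile_walk n v \<longleftrightarrow>
    v \<in> simple_walks n \<and> ((\<forall>j\<in>{0..n}. v j \<ge> 0) \<or> first_passage_bridge_neg n v)"

definition quantile_pair :: "nat \<Rightarrow> (nat \<Rightarrow> int) \<Rightarrow> nat \<Rightarrow> bool" where
  "quantile_pair n v k \<longleftrightarrow>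
    quantile_walk n v \<and> 1 \<le> k \<and> k \<le> n \<and>
    (\<forall>j\<in>{0..<k}. v j \<ge> 0) \<and> (\<forall>j\<in>{k..<n}. v j > v n)"

definition vervaat_pair :: "nat \<Rightarrow> (nat \<Rightarrow> int) \<Rightarrow> nat \<Rightarrow> bool" where
  "vervaat_pair n v k \<longleftrightarrow>
    v \<in> simple_walks n \<and> k \<le> n \<and>
    (\<forall>j\<in>{0..k}. v j \<ge> 0) \<and> (\<forall>j\<in>{k..<n}. v j > v n)"

lemma finite_simple_walks: "finite (simple_walks n)"
proof -
  have bnd: "\<bar>w j\<bar> \<le> int j" if "w \<in> simple_walks n" "j \<le> n" for w j
    using that(2)
  proof (induction j)
    case 0
    then show ?case using that(1) by (simp add: simple_walks_def)
  next
    case (Suc j)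
    have "Suc j \<in> {1..n}" using Suc.prems by simp
    then have "w (Suc j) - w (Suc j - 1) \<in> {1, -1}"
      using that(1) unfolding simple_walks_def by blast
    then show ?case using Suc by auto
  qed
  have "simple_walks n \<subseteq> {0..n} \<rightarrow>\<^sub>E {- int n..int n}"
  proof
    fix w assume w: "w \<in> simple_walks n"
    have "w j \<in> {- int n..int n}" if "j \<in> {0..n}" for j
      using bnd[OF w, of j] that by auto
    then show "w \<in> {0..n} \<rightarrow>\<^sub>E {- int n..int n}"
      using w by (auto simp: simple_walks_def PiE_iff)
  qed
  then show ?thesis
    by (rule finite_subset) (intro finite_PiE, auto)
qed

lemma is_quantile_perm_unique: "\<exists>!\<phi>. is_quantile_perm n w \<phi>"
proof -
  define f where "f = (\<lambda>i::nat. (w (i - 1), i - 1))"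
  have inj: "inj_on f {1..n}"
    by (auto simp: inj_on_def f_def)
  define L where "L = sorted_list_of_set (f ` {1..n})"
  have L: "sorted L" "distinct L" "set L = f ` {1..n}" "length L = n"
    using inj by (auto simp: L_def card_image)
  have key: "f \<circ> \<phi> = (\<lambda>i. (w (\<phi> i - 1), \<phi> i - 1))" for \<phi> :: "nat \<Rightarrow> nat"
    by (auto simp: f_def)
  show ?thesis
  proof (rule ex_ex1I)
    define \<phi> where "\<phi> = (\<lambda>i. if i \<in> {1..n} then snd (L ! (i - 1)) + 1 else i)"
    have f_phi: "f (\<phi> i) = L ! (i - 1)" and phi_in: "\<phi> i \<in> {1..n}" if "i \<in> {1..n}" for i
    proof -
      have "L ! (i - 1) \<in> f ` {1..n}"
        using that L by (metis One_nat_def Suc_le_lessD Suc_pred atLeastAtMost_iff nth_mem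
            less_eq_Suc_le)
      then show "f (\<phi> i) = L ! (i - 1)" "\<phi> i \<in> {1..n}"
        using that by (auto simp: \<phi>_def f_def)
    qed
    have mono: "strict_mono_on {1..n} (f \<circ> \<phi>)"
    proof (rule strict_mono_onI)
      fix i j assume ij: "i \<in> {1..n}" "j \<in> {1..n}" "i < j"
      have lt: "i - 1 < j - 1" "j - 1 < length L" using ij L(4) by auto
      have "sorted_wrt (<) L" using L(1,2) by (simp add: strict_sorted_iff)
      then have "L ! (i - 1) < L ! (j - 1)"
        using lt by (simp add: sorted_wrt_nth_less)
      then show "(f \<circ> \<phi>) i < (f \<circ> \<phi>) j" using f_phi ij by simp
    qed
    have "inj_on \<phi> {1..n}"
      using strict_mono_on_imp_inj_on[OF mono] by (rule inj_on_imageI2)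
    moreover have "\<phi> ` {1..n} \<subseteq> {1..n}" using phi_in by blast
    ultimately have "bij_betw \<phi> {1..n} {1..n}"
      by (simp add: bij_betw_def endo_inj_surj)
    then have "\<phi> permutes {1..n}"
      by (rule bij_imp_permutes) (auto simp: \<phi>_def)
    then show "\<exists>\<phi>. is_quantile_perm n w \<phi>"
      using mono unfolding is_quantile_perm_def key[symmetric] by blast
  next
    fix \<phi> \<psi> assume *: "is_quantile_perm n w \<phi>" "is_quantile_perm n w \<psi>"
    have list: "map (f \<circ> \<rho>) [1..<Suc n] = L" if "is_quantile_perm n w \<rho>" for \<rho>
    proof -
      have p: "\<rho> permutes {1..n}" and m: "strict_mono_on {1..n} (f \<circ> \<rho>)"
        using that unfolding is_quantile_perm_def key[symmetric] by auto
      have "sorted_wrt (<) (map (f \<circ> \<rho>) [1..<Suc n])"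
      proof -
        have "(f \<circ> \<rho>) i < (f \<circ> \<rho>) j"
          if "i \<in> {1..n}" "j \<in> {1..n}" "i < j" for i j
          using m that by (rule strict_mono_onD)
        then show ?thesis
          unfolding sorted_wrt_map
          by (intro sorted_wrt_mono_rel[OF _ sorted_wrt_upt]) auto
      qed
      moreover have "set (map (f \<circ> \<rho>) [1..<Suc n]) = f ` {1..n}"
      proof -
        have "set (map (f \<circ> \<rho>) [1..<Suc n]) = f ` (\<rho> ` {1..n})"
          by (simp only: set_map set_upt atLeastLessThanSuc_atLeastAtMost image_comp)
        then show ?thesis by (simp only: permutes_image[OF p])
      qed
      ultimately show ?thesis
        using L by (metis sorted_distinct_set_unique strict_sorted_iff)
    qed
    show "\<phi> = \<psi>"
    proof
      fix i show "\<phi> i = \<psi> i"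
      proof (cases "i \<in> {1..n}")
        case True
        have "map (f \<circ> \<phi>) [1..<Suc n] = map (f \<circ> \<psi>) [1..<Suc n]"
          using list * by simp
        then have "f (\<phi> i) = f (\<psi> i)" using True by (auto simp del: upt_Suc)
        moreover have "\<phi> i \<in> {1..n}" "\<psi> i \<in> {1..n}"
          using * True by (auto simp: is_quantile_perm_def permutes_in_image simp del: atLeastAtMost_iff)
        ultimately show ?thesis using inj by (auto dest: inj_onD)
      next
        case False
        then show ?thesis using * by (auto simp: is_quantile_perm_def permutes_not_in)
      qed
    qed
  qed
qed

end

theory Submission
  imports Defs
begin

text \<open>
  Both transforms lift to bijections from simple walks onto the same set, that of Vervaat pairs.
  For the Vervaat transform, w is sent to (V(w), n - \<tau>(w)), and since V(w) is a rotation of w,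
  rotating back inverts this map.

  For the quantile transform, w is sent to (Q(w), K) with K the number of times t < n such that
  w(t) \<le> w(n). The steps leaving the levels below l sum up to
  min(w(n), l) - min(0, l) plus the number of down-steps from l (a discrete Tanaka formula).
  This shows that (Q(w), K) is a Vervaat pair. It also shows that the direction of the last step of
  w and the place of that step in Q(w) can be read off (Q(w), K); deleting the step leaves the pair
  of the walk of length n - 1, so w is recovered by induction. Surjectivity needs no argument, since
  there are as many Vervaat pairs as walks.
\<close>

section \<open>Ranks of times and the quantile transform\<close>

text \<open>Time t is identified with the step from t to t + 1, so that \<phi>(time_rank t) = t + 1.\<close>
definition time_rank :: "nat \<Rightarrow> (nat \<Rightarrow> int) \<Rightarrow> nat \<Rightarrow> nat" where
  "time_rank n w t = card {s. s < n \<and> (w s, s) \<le> (w t, t)}"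

text \<open>The quantile transform without its permutation: the steps are selected by rank, so
  partial sums become sums over sets of times. Ranks are at least 1, so index 0 gives the empty
  sum.\<close>

definition rank_sum :: "nat \<Rightarrow> (nat \<Rightarrow> int) \<Rightarrow> nat \<Rightarrow> int" where
  "rank_sum n w j = (\<Sum>t | t < n \<and> time_rank n w t \<le> j. w (Suc t) - w t)"

text \<open>This is the K of the overview. Only times before n count, so it is the index in the
  quantile transform at which the steps leaving levels up to \<open>w n\<close> are used up.\<close>

definition end_rank :: "nat \<Rightarrow> (nat \<Rightarrow> int) \<Rightarrow> nat" where
  "end_rank n w = card {t. t < n \<and> w t \<le> w n}"

lemma time_rank_le_iff:
  assumes "s < n" "t < n"
  shows "time_rank n w s \<le> time_rank n w t \<longleftrightarrow> (w s, s) \<le> (w t, t)"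
proof
  assume "(w s, s) \<le> (w t, t)"
  then show "time_rank n w s \<le> time_rank n w t"
    unfolding time_rank_def by (intro card_mono) (auto intro: order_trans)
next
  assume le: "time_rank n w s \<le> time_rank n w t"
  show "(w s, s) \<le> (w t, t)"
  proof (rule ccontr)
    assume "\<not> (w s, s) \<le> (w t, t)"
    then have lt: "(w t, t) < (w s, s)" by (simp only: not_le)
    have "{r. r < n \<and> (w r, r) \<le> (w t, t)} \<subset> {r. r < n \<and> (w r, r) \<le> (w s, s)}"
    proof
      show "{r. r < n \<and> (w r, r) \<le> (w t, t)} \<subseteq> {r. r < n \<and> (w r, r) \<le> (w s, s)}"
        using lt by (blast intro: order_trans less_imp_le)
      have "s \<in> {r. r < n \<and> (w r, r) \<le> (w s, s)}" "s \<notin> {r. r < n \<and> (w r, r) \<le> (w t, t)}"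
        using assms lt by (simp_all only: mem_Collect_eq order_refl not_le[symmetric]) auto
      then show "{r. r < n \<and> (w r, r) \<le> (w t, t)} \<noteq> {r. r < n \<and> (w r, r) \<le> (w s, s)}"
        by blast
    qed
    then have "time_rank n w t < time_rank n w s"
      unfolding time_rank_def by (intro psubset_card_mono) auto
    with le show False by simp
  qed
qed

lemma time_rank_inj: "inj_on (time_rank n w) {..<n}"
proof (rule inj_onI)
  fix s t assume "s \<in> {..<n}" "t \<in> {..<n}" "time_rank n w s = time_rank n w t"
  then have "(w s, s) \<le> (w t, t)" "(w t, t) \<le> (w s, s)"
    using time_rank_le_iff[of s n t w] time_rank_le_iff[of t n s w] by auto
  then show "s = t" by auto
qed

lemma time_rank_pos: "t < n \<Longrightarrow> 1 \<le> time_rank n w t"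
  using card_gt_0_iff[of "{s. s < n \<and> (w s, s) \<le> (w t, t)}"]
  by (auto simp: time_rank_def Suc_le_eq)

lemma time_rank_le: "time_rank n w t \<le> n"
proof -
  have "time_rank n w t \<le> card {..<n}"
    unfolding time_rank_def by (rule card_mono) auto
  then show ?thesis by simp
qed

lemma time_rank_image: "time_rank n w ` {..<n} = {1..n}"
proof (rule card_subset_eq)
  show "time_rank n w ` {..<n} \<subseteq> {1..n}"
    using time_rank_pos time_rank_le by fastforce
  show "card (time_rank n w ` {..<n}) = card {1..n}"
    using time_rank_inj by (simp add: card_image)
qed simp

lemma time_rank_surj:
  assumes "1 \<le> j" "j \<le> n" obtains t where "t < n" "time_rank n w t = j"
proof -
  have "j \<in> time_rank n w ` {..<n}" using assms time_rank_image by simp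
  then show ?thesis using that by auto
qed

text \<open>Shifted down by one, the quantile permutation enumerates the times in increasing
  lexicographic order. The times preceding or equal to the i-th one are then the first i, so the
  enumeration is inverse to \<open>time_rank\<close>.\<close>

lemma rank_sum_quantile_transform:
  assumes "j \<le> n"
  shows "quantile_transform n w j = rank_sum n w j"
proof -
  define \<phi> where "\<phi> = quantile_perm n w"
  have "is_quantile_perm n w \<phi>"
    unfolding \<phi>_def quantile_perm_def by (rule theI'[OF is_quantile_perm_unique])
  then have p: "\<phi> permutes {1..n}"
    and m: "strict_mono_on {1..n} (\<lambda>i. (w (\<phi> i - 1), \<phi> i - 1))"
    by (auto simp: is_quantile_perm_def)
  define g where "g = (\<lambda>i. \<phi> i - 1)"
  have \<phi>: "\<phi> i \<ge> 1" "\<phi> i \<le> n" if "i \<in> {1..n}" for i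
    using permutes_in_image[OF p, of i] that by auto
  have inj: "inj_on g {1..n}"
  proof (rule inj_onI)
    fix i k assume ik: "i \<in> {1..n}" "k \<in> {1..n}" "g i = g k"
    then have "\<phi> i = \<phi> k" using \<phi>(1)[of i] \<phi>(1)[of k] by (simp add: g_def)
    then show "i = k" using permutes_inj[OF p] by (simp add: inj_eq)
  qed
  have sub: "g ` {1..n} \<subseteq> {..<n}" using \<phi> by (fastforce simp: g_def)
  have img: "g ` {1..n} = {..<n}"
    by (rule card_subset_eq) (use inj sub in \<open>auto simp: card_image\<close>)
  have le: "(w (g i), g i) \<le> (w (g k), g k) \<longleftrightarrow> i \<le> k" if "i \<in> {1..n}" "k \<in> {1..n}" for i k
    using strict_mono_on_less_eq[OF m that] by (simp add: g_def)
  have rk: "time_rank n w (g i) = i" if i: "i \<in> {1..n}" for i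
  proof -
    have "{s. s < n \<and> (w s, s) \<le> (w (g i), g i)} = g ` {1..i}"
    proof (intro set_eqI iffI)
      fix s assume s: "s \<in> {s. s < n \<and> (w s, s) \<le> (w (g i), g i)}"
      then have "s \<in> g ` {1..n}" using img by auto
      then obtain k where k: "k \<in> {1..n}" "s = g k" by blast
      then have "k \<le> i" using s le[OF k(1) i] by blast
      then show "s \<in> g ` {1..i}" using k by auto
    next
      fix s assume "s \<in> g ` {1..i}"
      then obtain k where k: "k \<in> {1..i}" "s = g k" by blast
      then have kn: "k \<in> {1..n}" using i by auto
      then have "g k < n" using sub by blast
      moreover have "(w s, s) \<le> (w (g i), g i)" using le[OF kn i] k by auto
      ultimately show "s \<in> {s. s < n \<and> (w s, s) \<le> (w (g i), g i)}" using k by blast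
    qed
    then have "time_rank n w (g i) = card (g ` {1..i})" by (simp only: time_rank_def)
    also have "\<dots> = i"
      using inj_on_subset[OF inj, of "{1..i}"] i by (simp add: card_image)
    finally show ?thesis .
  qed
  have set: "{t. t < n \<and> time_rank n w t \<le> j} = g ` {1..j}"
  proof (intro set_eqI iffI)
    fix s assume s: "s \<in> {t. t < n \<and> time_rank n w t \<le> j}"
    then have "s \<in> g ` {1..n}" using img by auto
    then show "s \<in> g ` {1..j}" using s rk by auto
  next
    fix s assume "s \<in> g ` {1..j}"
    then obtain k where k: "k \<in> {1..j}" "s = g k" by blast
    then have kn: "k \<in> {1..n}" using assms by auto
    then have "g k < n" using sub by blast
    then show "s \<in> {t. t < n \<and> time_rank n w t \<le> j}" using k rk[OF kn] by auto
  qed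
  have "rank_sum n w j = (\<Sum>i=1..j. w (Suc (g i)) - w (g i))"
    unfolding rank_sum_def set
    using inj_on_subset[OF inj, of "{1..j}"] assms by (simp add: sum.reindex)
  also have "\<dots> = (\<Sum>i=1..j. increment w (\<phi> i))"
  proof (rule sum.cong)
    fix i assume "i \<in> {1..j}"
    then have "Suc (g i) = \<phi> i" using \<phi>(1)[of i] assms by (simp add: g_def)
    then show "w (Suc (g i)) - w (g i) = increment w (\<phi> i)"
      by (simp add: increment_def g_def)
  qed simp
  finally show ?thesis using assms by (simp add: quantile_transform_def \<phi>_def)
qed

text \<open>All predecessors of a member of A lie in A, so its rank is at most
  \<open>card A\<close>. Ranks are injective and start at 1, which leaves no room for a further time
  of rank at most \<open>card A\<close>.\<close>

lemma down_set_eq: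
  assumes sub: "A \<subseteq> {..<n}"
    and down: "\<And>s t. s < n \<Longrightarrow> t \<in> A \<Longrightarrow> (w s, s) \<le> (w t, t) \<Longrightarrow> s \<in> A"
  shows "A = {t. t < n \<and> time_rank n w t \<le> card A}"
proof (rule card_subset_eq)
  show "finite {t. t < n \<and> time_rank n w t \<le> card A}" by simp
  have fin: "finite A" using sub finite_subset by blast
  show "A \<subseteq> {t. t < n \<and> time_rank n w t \<le> card A}"
  proof
    fix t assume t: "t \<in> A"
    then have "{s. s < n \<and> (w s, s) \<le> (w t, t)} \<subseteq> A" using down by blast
    then have "time_rank n w t \<le> card A"
      unfolding time_rank_def using fin by (rule card_mono[rotated])
    then show "t \<in> {t. t < n \<and> time_rank n w t \<le> card A}" using t sub by auto
  qed
  then have "card A \<le> card {t. t < n \<and> time_rank n w t \<le> card A}"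
    by (intro card_mono) auto
  moreover have "card {t. t < n \<and> time_rank n w t \<le> card A} \<le> card {1..card A}"
    by (rule card_inj_on_le[where f = "time_rank n w"])
      (use time_rank_inj time_rank_pos in \<open>auto intro: inj_on_subset\<close>)
  ultimately show "card A = card {t. t < n \<and> time_rank n w t \<le> card A}" by simp
qed

lemma rank_sum_down_set:
  assumes "A \<subseteq> {..<n}"
    and "\<And>s t. s < n \<Longrightarrow> t \<in> A \<Longrightarrow> (w s, s) \<le> (w t, t) \<Longrightarrow> s \<in> A"
  shows "rank_sum n w (card A) = (\<Sum>t\<in>A. w (Suc t) - w t)"
  unfolding rank_sum_def using down_set_eq[OF assms] by simp

lemma rank_sum_0: "rank_sum n w 0 = 0"
proof -
  have "\<not> time_rank n w t \<le> 0" if "t < n" for t using time_rank_pos[OF that, of w] by simp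
  then have "{t. t < n \<and> time_rank n w t \<le> 0} = {}" by blast
  then show ?thesis unfolding rank_sum_def by (simp only: sum.empty)
qed

lemma rank_sum_end: "rank_sum n w n = w n - w 0"
proof -
  have "{t. t < n \<and> time_rank n w t \<le> n} = {..<n}" using time_rank_le by auto
  then show ?thesis by (simp add: rank_sum_def sum_lessThan_telescope)
qed

lemma rank_sum_step:
  assumes "t < n"
  shows "rank_sum n w (time_rank n w t) - rank_sum n w (time_rank n w t - 1) = w (Suc t) - w t"
proof -
  have "{s. s < n \<and> time_rank n w s \<le> time_rank n w t}
      = insert t {s. s < n \<and> time_rank n w s \<le> time_rank n w t - 1}"
    using inj_onD[OF time_rank_inj, of n w] assms time_rank_pos[OF assms, of w]
    by (auto simp: le_eq_less_or_eq)
  moreover have "t \<notin> {s. s < n \<and> time_rank n w s \<le> time_rank n w t - 1}"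
    using time_rank_pos[OF assms, of w] by auto
  ultimately show ?thesis unfolding rank_sum_def by simp
qed

section \<open>Levels of walks\<close>

text \<open>Simple walks without extensionality, so that a walk may be cut at an earlier time,
  negated or replaced by a rank sum without changing values beyond the end.\<close>

definition unit_steps :: "nat \<Rightarrow> (nat \<Rightarrow> int) \<Rightarrow> bool" where
  "unit_steps n w \<longleftrightarrow> w 0 = 0 \<and> (\<forall>t<n. w (Suc t) = w t + 1 \<or> w (Suc t) = w t - 1)"

definition ups :: "nat \<Rightarrow> (nat \<Rightarrow> int) \<Rightarrow> int \<Rightarrow> nat" where
  "ups n w l = card {t. t < n \<and> w t = l \<and> w (Suc t) = l + 1}"

definition downs :: "nat \<Rightarrow> (nat \<Rightarrow> int) \<Rightarrow> int \<Rightarrow> nat" where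
  "downs n w l = card {t. t < n \<and> w t = l \<and> w (Suc t) = l - 1}"

lemma simple_walks_iff:
  "w \<in> simple_walks n \<longleftrightarrow> w \<in> extensional {0..n} \<and> unit_steps n w"
proof -
  have "(\<forall>i\<in>{1..n}. w i - w (i - 1) \<in> {1, -1}) \<longleftrightarrow>
      (\<forall>t<n. w (Suc t) = w t + 1 \<or> w (Suc t) = w t - 1)" (is "?l \<longleftrightarrow> ?r")
  proof
    assume l: ?l
    show ?r
    proof (intro allI impI)
      fix t assume "t < n"
      then have "w (Suc t) - w (Suc t - 1) \<in> {1, -1}" by (intro l[rule_format]) auto
      then show "w (Suc t) = w t + 1 \<or> w (Suc t) = w t - 1" by auto
    qed
  next
    assume r: ?r
    show ?l
    proof
      fix i assume "i \<in> {1..n}"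
      then have "w (Suc (i - 1)) = w (i - 1) + 1 \<or> w (Suc (i - 1)) = w (i - 1) - 1" "Suc (i - 1) = i"
        using r[rule_format, of "i - 1"] by auto
      then show "w i - w (i - 1) \<in> {1, -1}" by auto
    qed
  qed
  then show ?thesis by (auto simp: simple_walks_def unit_steps_def PiE_def)
qed

lemma unit_steps_mono: "unit_steps n w \<Longrightarrow> m \<le> n \<Longrightarrow> unit_steps m w"
  by (auto simp: unit_steps_def)

lemma unit_steps_cases:
  assumes "unit_steps n w" "t < n"
  obtains "w (Suc t) = w t + 1" | "w (Suc t) = w t - 1"
  using assms by (auto simp: unit_steps_def)

text \<open>A discrete intermediate value theorem: the induction strips the final stretch of times
  below l until the step that enters it from l is the last one.\<close>

lemma descent:
  assumes "unit_steps n w" "s \<le> n" "l \<le> w s" "w n < l"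
  shows "\<exists>t. s \<le> t \<and> t < n \<and> w t = l \<and> w (Suc t) = l - 1"
  using assms
proof (induction n)
  case (Suc n)
  have un: "unit_steps n w" using Suc.prems(1) by (rule unit_steps_mono) simp
  have sn: "s \<le> n" using Suc.prems by (cases "s = Suc n") auto
  show ?case
  proof (cases "w n < l")
    case True
    then show ?thesis using Suc.IH[OF un sn] Suc.prems by (auto intro: less_SucI)
  next
    case False
    have "w (Suc n) = w n + 1 \<or> w (Suc n) = w n - 1"
      using Suc.prems(1) by (simp add: unit_steps_def)
    then have "w n = l" "w (Suc n) = l - 1" using False Suc.prems by auto
    then show ?thesis using sn by blast
  qed
qed auto

lemma ascent:
  assumes "unit_steps n w" "s \<le> n" "w s \<le> l" "l < w n"
  shows "\<exists>t. s \<le> t \<and> t < n \<and> w t = l \<and> w (Suc t) = l + 1"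
proof -
  have "unit_steps n (\<lambda>i. - w i)" using assms(1) by (auto simp: unit_steps_def)
  from descent[OF this assms(2), of "- l"] assms(3,4) show ?thesis by force
qed

text \<open>Discrete Tanaka formula: \<open>min (w t) l\<close> follows the walk on steps from below
  l and is constant on steps from l or above, except that a down-step from l lowers it by 1. The
  \<open>downs\<close> term compensates for these.\<close>

lemma sum_steps_below:
  assumes "unit_steps n w"
  shows "(\<Sum>t | t < n \<and> w t < l. w (Suc t) - w t) = min (w n) l - min 0 l + int (downs n w l)"
  using assms
proof (induction n)
  case 0
  then show ?case by (simp add: unit_steps_def downs_def)
next
  case (Suc n)
  have un: "unit_steps n w" using Suc.prems by (rule unit_steps_mono) simp
  have step: "w (Suc n) = w n + 1 \<or> w (Suc n) = w n - 1"
    using Suc.prems by (simp add: unit_steps_def)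
  have s: "{t. t < Suc n \<and> w t < l} = (if w n < l then insert n {t. t < n \<and> w t < l} else {t. t < n \<and> w t < l})"
    by (auto simp: less_Suc_eq)
  have d: "{t. t < Suc n \<and> w t = l \<and> w (Suc t) = l - 1} =
      (if w n = l \<and> w (Suc n) = l - 1 then insert n {t. t < n \<and> w t = l \<and> w (Suc t) = l - 1}
       else {t. t < n \<and> w t = l \<and> w (Suc t) = l - 1})"
    by (auto simp: less_Suc_eq)
  have d': "downs (Suc n) w l = downs n w l + (if w n = l \<and> w (Suc n) = l - 1 then 1 else 0)"
    unfolding downs_def d by simp
  show ?case using Suc.IH[OF un] step unfolding s d' by auto
qed

lemma sum_steps_at:
  assumes "unit_steps n w"
  shows "(\<Sum>t | t < n \<and> w t = l. w (Suc t) - w t) = int (ups n w l) - int (downs n w l)"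
    and "card {t. t < n \<and> w t = l} = ups n w l + downs n w l"
proof -
  have s: "{t. t < n \<and> w t = l} =
      {t. t < n \<and> w t = l \<and> w (Suc t) = l + 1} \<union> {t. t < n \<and> w t = l \<and> w (Suc t) = l - 1}"
    using assms by (auto simp: unit_steps_def)
  show "card {t. t < n \<and> w t = l} = ups n w l + downs n w l"
    unfolding ups_def downs_def by (subst s, rule card_Un_disjoint) auto
  show "(\<Sum>t | t < n \<and> w t = l. w (Suc t) - w t) = int (ups n w l) - int (downs n w l)"
    unfolding ups_def downs_def by (subst s, subst sum.union_disjoint) auto
qed

lemma rank_sum_below:
  assumes "unit_steps n w"
  shows "rank_sum n w (card {t. t < n \<and> w t < l}) = min (w n) l - min 0 l + int (downs n w l)"
proof -
  have "rank_sum n w (card {t. t < n \<and> w t < l}) = (\<Sum>t | t < n \<and> w t < l. w (Suc t) - w t)"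
    by (rule rank_sum_down_set) auto
  then show ?thesis by (simp add: sum_steps_below[OF assms])
qed

lemma card_less_Suc_level:
  assumes "unit_steps n w"
  shows "card {t. t < n \<and> w t < l + 1} = card {t. t < n \<and> w t < l} + ups n w l + downs n w l"
proof -
  have "{t. t < n \<and> w t < l + 1} = {t. t < n \<and> w t < l} \<union> {t. t < n \<and> w t = l}" by auto
  then have "card {t. t < n \<and> w t < l + 1} = card {t. t < n \<and> w t < l} + card {t. t < n \<and> w t = l}"
    by (simp only:) (rule card_Un_disjoint, auto)
  then show ?thesis by (simp add: sum_steps_at(2)[OF assms])
qed

text \<open>The steps from l itself contribute up-steps minus down-steps, which replaces the
  down-step count of the Tanaka formula by the up-step count.\<close>

lemma rank_sum_less_Suc_level:
  assumes "unit_steps n w"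
  shows "rank_sum n w (card {t. t < n \<and> w t < l + 1}) = min (w n) l - min 0 l + int (ups n w l)"
proof -
  have "{t. t < n \<and> w t < l + 1} = {t. t < n \<and> w t < l} \<union> {t. t < n \<and> w t = l}" by auto
  then have "(\<Sum>t | t < n \<and> w t < l + 1. w (Suc t) - w t) =
      (\<Sum>t | t < n \<and> w t < l. w (Suc t) - w t) + (\<Sum>t | t < n \<and> w t = l. w (Suc t) - w t)"
    by (simp only:) (rule sum.union_disjoint, auto)
  then have "(\<Sum>t | t < n \<and> w t < l + 1. w (Suc t) - w t) = min (w n) l - min 0 l + int (ups n w l)"
    unfolding sum_steps_below[OF assms] sum_steps_at(1)[OF assms] by simp
  moreover have "rank_sum n w (card {t. t < n \<and> w t < l + 1}) =
      (\<Sum>t | t < n \<and> w t < l + 1. w (Suc t) - w t)"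
    by (rule rank_sum_down_set) auto
  ultimately show ?thesis by simp
qed

section \<open>The quantile transform and the end rank form a Vervaat pair\<close>

lemma end_rank_eq: "end_rank n w = card {t. t < n \<and> w t < w n + 1}"
  by (simp add: end_rank_def)

lemma rank_sum_end_rank:
  assumes "unit_steps n w"
  shows "rank_sum n w (end_rank n w) = max (w n) 0 + int (ups n w (w n))"
  unfolding end_rank_eq rank_sum_less_Suc_level[OF assms] by simp

lemma time_rank_le_end_rank:
  assumes "t < n"
  shows "time_rank n w t \<le> end_rank n w \<longleftrightarrow> w t \<le> w n"
proof -
  have "{t. t < n \<and> w t \<le> w n} = {t. t < n \<and> time_rank n w t \<le> card {t. t < n \<and> w t \<le> w n}}"
    by (rule down_set_eq) auto
  then show ?thesis using assms unfolding end_rank_def by blast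
qed

text \<open>The steps preceding that of time t are all steps from lower levels, given by the Tanaka
  formula, and the steps from level \<open>w t\<close> before t, which only involve the walk cut at
  t.\<close>

lemma rank_sum_before:
  assumes "unit_steps n w" "t < n"
  shows "rank_sum n w (time_rank n w t - 1) =
    min (w n) (w t) - min 0 (w t) + int (downs n w (w t)) + int (ups t w (w t)) - int (downs t w (w t))"
proof -
  define A where "A = {s. s < n \<and> w s < w t} \<union> {s. s < t \<and> w s = w t}"
  have "{s. s < n \<and> (w s, s) \<le> (w t, t)} = insert t A"
    using assms(2) by (auto simp: A_def)
  moreover have "t \<notin> A" "finite A" by (auto simp: A_def)
  ultimately have "time_rank n w t - 1 = card A" by (simp add: time_rank_def)
  moreover have "rank_sum n w (card A) = (\<Sum>s\<in>A. w (Suc s) - w s)"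
    by (rule rank_sum_down_set) (use assms(2) in \<open>auto simp: A_def\<close>)
  moreover have "(\<Sum>s\<in>A. w (Suc s) - w s) =
      (\<Sum>s | s < n \<and> w s < w t. w (Suc s) - w s) + (\<Sum>s | s < t \<and> w s = w t. w (Suc s) - w s)"
    unfolding A_def by (rule sum.union_disjoint) auto
  moreover have "unit_steps t w" using assms by (auto intro: unit_steps_mono)
  note sum_steps_at(1)[OF this, of "w t"]
  ultimately show ?thesis
    using sum_steps_below[OF assms(1), of "w t"] by simp
qed

lemma unit_steps_rank_sum:
  assumes "unit_steps n w"
  shows "unit_steps n (rank_sum n w)"
  unfolding unit_steps_def
proof (intro conjI allI impI)
  show "rank_sum n w 0 = 0" by (rule rank_sum_0)
next
  fix j assume "j < n"
  then obtain t where t: "t < n" "time_rank n w t = Suc j"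
    using time_rank_surj[of "Suc j" n w] by auto
  show "rank_sum n w (Suc j) = rank_sum n w j + 1 \<or> rank_sum n w (Suc j) = rank_sum n w j - 1"
    using rank_sum_step[OF t(1), of w] t unit_steps_cases[OF assms t(1)] by force
qed

text \<open>Both inequalities come from \<open>rank_sum_before\<close> at the time t of the next
  step. If \<open>w t \<le> w n\<close>, no term makes the value negative, since
  \<open>downs t\<close> is at most \<open>downs n\<close>. If \<open>w t > w n\<close>, the walk
  must still descend through level \<open>w t\<close>, so the difference of the down-step counts is
  positive.\<close>

lemma vervaat_pair_quantile_transform:
  assumes w: "w \<in> simple_walks n"
  shows "vervaat_pair n (quantile_transform n w) (end_rank n w)"
proof -
  have us: "unit_steps n w" using w by (simp add: simple_walks_iff)
  define v where "v = quantile_transform n w"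
  define K where "K = end_rank n w"
  have v: "v j = rank_sum n w j" if "j \<le> n" for j
    using that by (simp add: v_def rank_sum_quantile_transform)
  have "unit_steps n v"
    using unit_steps_rank_sum[OF us] by (simp add: unit_steps_def v)
  then have walk: "v \<in> simple_walks n"
    by (simp add: simple_walks_iff v_def quantile_transform_def)
  have "K \<le> card {..<n}" unfolding K_def end_rank_def by (rule card_mono) auto
  then have Kn: "K \<le> n" by simp
  have downs_le: "downs t w l \<le> downs n w l" if "t < n" for t l
    unfolding downs_def by (rule card_mono) (use that in auto)
  have before: "\<exists>t<n. time_rank n w t = Suc j \<and> v j = min (w n) (w t) - min 0 (w t) +
      int (downs n w (w t)) + int (ups t w (w t)) - int (downs t w (w t))" if j: "j < n" for j
  proof -
    obtain t where t: "t < n" "time_rank n w t = Suc j"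
      using j time_rank_surj[of "Suc j" n w] by auto
    then show ?thesis using rank_sum_before[OF us t(1)] v[of j] j by auto
  qed
  have "v j \<ge> 0" if "j \<le> K" for j
  \<comment> \<open>The index K needs its own argument: the step after it, if there is one, leaves a
    level above \<open>w n\<close>.\<close>
  proof (cases "j = K")
    case True
    then show ?thesis using rank_sum_end_rank[OF us] v[OF Kn] by (simp add: K_def)
  next
    case False
    then have j: "j < n" "Suc j \<le> K" using that Kn by auto
    then obtain t where t: "t < n" "time_rank n w t = Suc j" "v j = min (w n) (w t) - min 0 (w t) +
      int (downs n w (w t)) + int (ups t w (w t)) - int (downs t w (w t))"
      using before by blast
    have "w t \<le> w n" using time_rank_le_end_rank[OF t(1), of w] t(2) j by (simp add: K_def)
    then show ?thesis using t(3) downs_le[OF t(1), of "w t"] by auto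
  qed
  moreover have "v j > v n" if "K \<le> j" "j < n" for j
  proof -
    obtain t where t: "t < n" "time_rank n w t = Suc j" "v j = min (w n) (w t) - min 0 (w t) +
      int (downs n w (w t)) + int (ups t w (w t)) - int (downs t w (w t))"
      using before[OF \<open>j < n\<close>] by blast
    have gt: "w n < w t" using time_rank_le_end_rank[OF t(1), of w] t(2) that by (simp add: K_def)
    \<comment> \<open>The walk ends below \<open>w t\<close>, so it leaves this level downwards at
      some time s from t on; this down-step is counted by \<open>downs n\<close> but not by
      \<open>downs t\<close>.\<close>
    obtain s where s: "t \<le> s" "s < n" "w s = w t" "w (Suc s) = w t - 1"
      using descent[OF us _ order_refl gt] t(1) by auto
    have "downs t w (w t) < downs n w (w t)"
      unfolding downs_def
    proof (rule psubset_card_mono)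
      have "s \<in> {r. r < n \<and> w r = w t \<and> w (Suc r) = w t - 1}" using s by simp
      moreover have "s \<notin> {r. r < t \<and> w r = w t \<and> w (Suc r) = w t - 1}" using s by simp
      ultimately show "{r. r < t \<and> w r = w t \<and> w (Suc r) = w t - 1} \<subset> {r. r < n \<and> w r = w t \<and> w (Suc r) = w t - 1}"
        using t(1) by auto
    qed simp
    moreover have "v n = w n" using v[of n] rank_sum_end[of n w] us by (simp add: unit_steps_def)
    ultimately show ?thesis using t(3) gt by auto
  qed
  ultimately show ?thesis
    using walk Kn unfolding vervaat_pair_def v_def[symmetric] K_def[symmetric] by auto
qed

section \<open>Recovering a walk from its quantile transform\<close>

text \<open>Time n comes after every other visit to its level. Hence the rank of the last step of a
  walk of length n + 1 yields the end rank of the walk with that step deleted.\<close>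

lemma time_rank_last: "time_rank (Suc n) w n = Suc (end_rank n w)"
proof -
  have "{s. s < Suc n \<and> (w s, s) \<le> (w n, n)} = insert n {t. t < n \<and> w t \<le> w n}" by auto
  then show ?thesis by (simp add: time_rank_def end_rank_def)
qed

lemma time_rank_last': "time_rank (Suc n) w n = card {t. t < Suc n \<and> w t < w n + 1}"
proof -
  have "{s. s < Suc n \<and> (w s, s) \<le> (w n, n)} = {t. t < Suc n \<and> w t < w n + 1}" by auto
  then show ?thesis by (simp add: time_rank_def)
qed

lemma time_rank_Suc:
  assumes "t < n"
  shows "time_rank (Suc n) w t =
    time_rank n w t + (if time_rank (Suc n) w n \<le> time_rank (Suc n) w t then 1 else 0)"
proof -
  have iff: "time_rank (Suc n) w n \<le> time_rank (Suc n) w t \<longleftrightarrow> (w n, n) \<le> (w t, t)"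
    by (rule time_rank_le_iff) (use assms in auto)
  have "{s. s < Suc n \<and> (w s, s) \<le> (w t, t)} =
      (if (w n, n) \<le> (w t, t) then insert n {s. s < n \<and> (w s, s) \<le> (w t, t)}
       else {s. s < n \<and> (w s, s) \<le> (w t, t)})"
    by (auto simp: less_Suc_eq)
  then show ?thesis unfolding iff unfolding time_rank_def by simp
qed

text \<open>Deleting the last step leaves the order of the other times unchanged, so in the
  transform it removes one step, at the rank of time n: earlier values stay, later ones shift by one
  index and lose the increment.\<close>

lemma rank_sum_remove_last:
  "rank_sum n w j =
    (if j < time_rank (Suc n) w n then rank_sum (Suc n) w j
     else rank_sum (Suc n) w (Suc j) - (w (Suc n) - w n))"
proof -
  have neq: "time_rank (Suc n) w t \<noteq> time_rank (Suc n) w n" if "t < n" for t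
    using inj_onD[OF time_rank_inj, of "Suc n" w t n] that by auto
  show ?thesis
  proof (cases "j < time_rank (Suc n) w n")
    case True
    have "time_rank (Suc n) w t \<le> j \<longleftrightarrow> time_rank n w t \<le> j" if "t < n" for t
      using time_rank_Suc[OF that, of w] True neq[OF that] by (auto split: if_splits)
    moreover have "\<not> time_rank (Suc n) w n \<le> j" using True by simp
    ultimately have "{t. t < Suc n \<and> time_rank (Suc n) w t \<le> j} =
        {t. t < n \<and> time_rank n w t \<le> j}"
      by (auto simp: less_Suc_eq)
    then show ?thesis using True by (simp add: rank_sum_def)
  next
    case False
    have "time_rank (Suc n) w t \<le> Suc j \<longleftrightarrow> time_rank n w t \<le> j" if "t < n" for t
      using time_rank_Suc[OF that, of w] False neq[OF that] by (auto split: if_splits)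
    moreover have "time_rank (Suc n) w n \<le> Suc j" using False by simp
    ultimately have "{t. t < Suc n \<and> time_rank (Suc n) w t \<le> Suc j} =
        insert n {t. t < n \<and> time_rank n w t \<le> j}"
      by (auto simp: less_Suc_eq)
    then show ?thesis using False by (simp add: rank_sum_def)
  qed
qed

text \<open>The last departure from the final level e is opposite to the last step, and it is the K-th step of
  the quantile transform unless e is never visited before the end.\<close>
lemma last_step_down_iff:
  assumes us: "unit_steps (Suc n) w"
  defines "e \<equiv> w (Suc n)" and "K \<equiv> end_rank (Suc n) w" and "v \<equiv> rank_sum (Suc n) w"
  shows "w (Suc n) = w n - 1 \<longleftrightarrow> K = 0 \<or> v K - v (K - 1) = 1 \<and> v K > max e 0"
proof -
  have un: "unit_steps n w" using us by (rule unit_steps_mono) simp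
  have vK: "v K = max e 0 + int (ups (Suc n) w e)"
    unfolding v_def K_def e_def by (rule rank_sum_end_rank[OF us])
  \<comment> \<open>Every time at a level up to e precedes or equals the last visit m to e
    lexicographically, so the rank of m counts all of them and equals K.\<close>
  have last_visit: "\<exists>m. m < Suc n \<and> w m = e \<and> time_rank (Suc n) w m = K \<and> (\<forall>t. t < Suc n \<longrightarrow> w t = e \<longrightarrow> t \<le> m)"
    if ex: "\<exists>t<Suc n. w t = e"
  proof -
    define m where "m = Max {t. t < Suc n \<and> w t = e}"
    have "finite {t. t < Suc n \<and> w t = e}" "{t. t < Suc n \<and> w t = e} \<noteq> {}" using ex by auto
    note M = Max_in[OF this] Max_ge[OF this(1)]
    have m: "m < Suc n" "w m = e" "\<And>t. t < Suc n \<Longrightarrow> w t = e \<Longrightarrow> t \<le> m"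
      using M unfolding m_def by auto
    have "{s. s < Suc n \<and> (w s, s) \<le> (w m, m)} = {t. t < Suc n \<and> w t \<le> e}"
      using m by auto
    then have "time_rank (Suc n) w m = K"
      by (simp add: time_rank_def K_def end_rank_def e_def)
    with m show ?thesis by blast
  qed
  have step: "w (Suc n) = w n + 1 \<or> w (Suc n) = w n - 1"
    using us by (simp add: unit_steps_def)
  show ?thesis
  proof (cases "w (Suc n) = w n - 1")
    case down: True
    \<comment> \<open>Since K is nonzero, some time is at or below e, while
      \<open>w n = e + 1\<close>. The walk therefore crosses e upwards, and after its last visit it
      can only do so by leaving e at that very visit.\<close>
    have "v K - v (K - 1) = 1 \<and> v K > max e 0" if "K \<noteq> 0"
    proof -
      have "{t. t < Suc n \<and> w t \<le> e} \<noteq> {}"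
        using that unfolding K_def end_rank_def e_def by (metis card.empty)
      then obtain t where t: "t < Suc n" "w t \<le> e" by blast
      have "e < w n" using down by (simp add: e_def)
      then have "\<exists>s\<ge>t. s < n \<and> w s = e \<and> w (Suc s) = e + 1"
        using ascent[OF un, of t e] t by auto
      then have "\<exists>t<Suc n. w t = e" using less_SucI by blast
      then obtain m where m: "m < Suc n" "w m = e" "time_rank (Suc n) w m = K"
        "\<And>t. t < Suc n \<Longrightarrow> w t = e \<Longrightarrow> t \<le> m"
        using last_visit by blast
      obtain s where s: "m \<le> s" "s < n" "w s = e" "w (Suc s) = e + 1"
        using ascent[OF un, of m e] m \<open>e < w n\<close> by auto
      then have "s = m" using m(4)[of s] by auto
      then have "v K - v (K - 1) = 1"
        using rank_sum_step[OF m(1), of w] m s by (simp add: v_def)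
      moreover have "{t. t < Suc n \<and> w t = e \<and> w (Suc t) = e + 1} \<noteq> {}"
        using s by auto
      then have "ups (Suc n) w e > 0" unfolding ups_def by (simp only: card_gt_0_iff) simp
      ultimately show ?thesis using vK by simp
    qed
    then show ?thesis using down by blast
  next
    case False
    then have up: "w n = e - 1" using step by (simp add: e_def)
    have "n \<in> {t. t < Suc n \<and> w t \<le> w (Suc n)}" using up by (simp add: e_def)
    then have "{t. t < Suc n \<and> w t \<le> w (Suc n)} \<noteq> {}" by blast
    then have "K \<noteq> 0" unfolding K_def end_rank_def by (subst card_0_eq) simp_all
    \<comment> \<open>If e is visited before the end, its last departure is a down-step and the
      first conjunct fails. Otherwise e has no up-steps, so \<open>v K = max e 0\<close> and the
      second conjunct fails.\<close>
    moreover have "\<not> (v K - v (K - 1) = 1 \<and> v K > max e 0)"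
    proof (cases "\<exists>t<Suc n. w t = e")
      case True
      then obtain m where m: "m < Suc n" "w m = e" "time_rank (Suc n) w m = K"
        "\<And>t. t < Suc n \<Longrightarrow> w t = e \<Longrightarrow> t \<le> m"
        using last_visit by blast
      obtain s where s: "m \<le> s" "s < n" "w s = e" "w (Suc s) = e - 1"
        using descent[OF un, of m e] m up by auto
      then have "s = m" using m(4)[of s] by auto
      then have "v K - v (K - 1) = - 1"
        using rank_sum_step[OF m(1), of w] m s by (simp add: v_def)
      then show ?thesis by simp
    next
      case False
      then have "{t. t < Suc n \<and> w t = e \<and> w (Suc t) = e + 1} = {}" by blast
      then have "ups (Suc n) w e = 0" unfolding ups_def by (simp only: card.empty)
      then show ?thesis using vK by simp
    qed
    ultimately show ?thesis using False by blast
  qed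
qed

text \<open>The last step leaves level e - 1, where e is the final level, so k closes the levels
  below e and the steps from e occupy ranks k + 1 to K. Eliminating the numbers of up-steps and
  down-steps from e leaves an expression in K, \<open>v K\<close> and e, and e is the final value of
  v.\<close>

lemma rank_sum_last_up:
  assumes us: "unit_steps (Suc n) w" and up: "w (Suc n) = w n + 1"
  defines "K \<equiv> end_rank (Suc n) w" and "v \<equiv> rank_sum (Suc n) w" and "k \<equiv> time_rank (Suc n) w n"
  shows "v k + int k = int K - v K + 2 * max (w (Suc n)) 0"
proof -
  define e where "e = w (Suc n)"
  have k: "k = card {t. t < Suc n \<and> w t < e}"
    using time_rank_last'[of n w] up by (simp add: k_def e_def)
  have "v k = e - min 0 e + int (downs (Suc n) w e)"
    using rank_sum_below[OF us, of e] k by (simp add: v_def e_def)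
  moreover have "K = k + ups (Suc n) w e + downs (Suc n) w e"
    using card_less_Suc_level[OF us, of e] k by (simp add: K_def end_rank_eq e_def)
  moreover have "v K = max e 0 + int (ups (Suc n) w e)"
    using rank_sum_end_rank[OF us] by (simp add: v_def K_def e_def)
  ultimately show ?thesis by (simp add: e_def[symmetric])
qed

text \<open>Here the last step leaves level e + 1, so K closes the levels below e + 1 and k closes
  level e + 1 itself. The same elimination now determines k - v(k).\<close>

lemma rank_sum_last_down:
  assumes us: "unit_steps (Suc n) w" and down: "w (Suc n) = w n - 1"
  defines "K \<equiv> end_rank (Suc n) w" and "v \<equiv> rank_sum (Suc n) w" and "k \<equiv> time_rank (Suc n) w n"
    and "e \<equiv> w (Suc n)"
  shows "int k - v k = int K + v K - 2 * (e - min 0 (e + 1))"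
proof -
  have k: "k = card {t. t < Suc n \<and> w t < (e + 1) + 1}"
    using time_rank_last'[of n w] down by (simp add: k_def e_def)
  have K: "K = card {t. t < Suc n \<and> w t < e + 1}"
    by (simp add: K_def end_rank_eq e_def)
  have "v k = e - min 0 (e + 1) + int (ups (Suc n) w (e + 1))"
    using rank_sum_less_Suc_level[OF us, of "e + 1"] k by (simp add: v_def e_def)
  moreover have "k = K + ups (Suc n) w (e + 1) + downs (Suc n) w (e + 1)"
    using card_less_Suc_level[OF us, of "e + 1"] k K by simp
  moreover have "v K = e - min 0 (e + 1) + int (downs (Suc n) w (e + 1))"
    using rank_sum_below[OF us, of "e + 1"] K by (simp add: v_def e_def)
  ultimately show ?thesis by simp
qed

section \<open>Locating the last step and induction on the length\<close>

lemma unit_steps_add_time_mono: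
  assumes "unit_steps n v" "j \<le> n" "i \<le> j"
  shows "v i + int i \<le> v j + int j"
  using assms(3,2)
proof (induction j rule: dec_induct)
  case (step j)
  then show ?case using unit_steps_cases[OF assms(1), of j] by force
qed simp

text \<open>v(j) + j is nondecreasing and increases at up-steps, so it identifies an up-step. Down-steps
  are treated by applying this to - v.\<close>
lemma up_time_unique:
  assumes us: "unit_steps n v" and le: "i \<le> n" "j \<le> n" and "1 \<le> i" "1 \<le> j"
    and "v i - v (i - 1) = 1" "v j - v (j - 1) = 1" and eq: "v i + int i = v j + int j"
  shows "i = j"
proof (rule ccontr)
  assume "i \<noteq> j"
  then have "i \<le> j - 1 \<or> j \<le> i - 1" by auto
  then show False
  proof
    assume ij: "i \<le> j - 1"
    have "j - 1 \<le> n" using le by simp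
    from unit_steps_add_time_mono[OF us this ij] show False using assms by (simp add: of_nat_diff)
  next
    assume ji: "j \<le> i - 1"
    have "i - 1 \<le> n" using le by simp
    from unit_steps_add_time_mono[OF us this ji] show False using assms by (simp add: of_nat_diff)
  qed
qed

lemma unit_steps_eq_if_rank_sum_eq:
  assumes "unit_steps n w" "unit_steps n w'"
    and "\<And>j. j \<le> n \<Longrightarrow> rank_sum n w j = rank_sum n w' j"
    and "end_rank n w = end_rank n w'" and "i \<le> n"
  shows "w i = w' i"
  using assms
proof (induction n arbitrary: i)
  case 0
  then show ?case by (simp add: unit_steps_def)
next
  case (Suc n)
  note us = Suc.prems(1,2) and eq = Suc.prems(3) and K = Suc.prems(4)
  define v where "v = rank_sum (Suc n) w"
  have eq': "rank_sum (Suc n) w' j = v j" if "j \<le> Suc n" for j using eq[OF that] by (simp add: v_def)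
  define k where "k = (\<lambda>w. time_rank (Suc n) w n)"
  have k: "1 \<le> k u" "k u \<le> Suc n" for u
    unfolding k_def by (simp_all only: time_rank_pos time_rank_le lessI)
  have un: "unit_steps n w" "unit_steps n w'"
    using us unit_steps_mono[of "Suc n" _ n] by auto
  have end_eq: "w (Suc n) = w' (Suc n)"
    using eq[of "Suc n"] us rank_sum_end[of "Suc n" w] rank_sum_end[of "Suc n" w']
    by (simp add: unit_steps_def)
  have Kn: "end_rank (Suc n) w' \<le> Suc n"
    using card_mono[of "{..<Suc n}" "{t. t < Suc n \<and> w' t \<le> w' (Suc n)}"] by (auto simp: end_rank_def)
  have usv: "unit_steps (Suc n) v" unfolding v_def by (rule unit_steps_rank_sum) (rule us(1))
  have step: "w (Suc n) = w n + 1 \<or> w (Suc n) = w n - 1" "w' (Suc n) = w' n + 1 \<or> w' (Suc n) = w' n - 1"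
    using us by (auto simp: unit_steps_def)
  have kstep: "v (k w) - v (k w - 1) = w (Suc n) - w n" "v (k w') - v (k w' - 1) = w' (Suc n) - w' n"
    using rank_sum_step[of n "Suc n" w] rank_sum_step[of n "Suc n" w'] k(2)[of w'] eq'[of "k w'"] eq'[of "k w' - 1"]
    unfolding v_def k_def by auto
  have down_iff: "w (Suc n) = w n - 1 \<longleftrightarrow> w' (Suc n) = w' n - 1"
    using last_step_down_iff[OF us(1)] last_step_down_iff[OF us(2)]
      eq'[of "end_rank (Suc n) w'"] eq'[of "end_rank (Suc n) w' - 1"] Kn K end_eq
    by (simp add: v_def)
  \<comment> \<open>The formulas for the last rank have the same right side for both walks, so the
    two ranks give equal values of v(j) + j or of j - v(j) at steps of v in the same
    direction.\<close>
  have kk: "k w = k w'"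
  proof (cases "w (Suc n) = w n - 1")
    case True
    then have True': "w' (Suc n) = w' n - 1" using down_iff by simp
    have *: "int (k w) - v (k w) = int (k w') - v (k w')"
      using rank_sum_last_down[OF us(1) True] rank_sum_last_down[OF us(2) True']
        eq'[OF Kn] eq'[OF k(2)[of w']] K end_eq by (simp add: v_def k_def)
    have "unit_steps (Suc n) (\<lambda>i. - v i)" using usv by (auto simp: unit_steps_def)
    then show ?thesis
      by (rule up_time_unique) (use * k kstep True True' in auto)
  next
    case False
    then have up: "w (Suc n) = w n + 1" "w' (Suc n) = w' n + 1" using down_iff step by auto
    have *: "v (k w) + int (k w) = v (k w') + int (k w')"
      using rank_sum_last_up[OF us(1) up(1)] rank_sum_last_up[OF us(2) up(2)]
        eq'[OF Kn] eq'[OF k(2)[of w']] K end_eq by (simp add: v_def k_def)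
    show ?thesis
      by (rule up_time_unique[OF usv]) (use * k kstep up in auto)
  qed
  have step_eq: "w (Suc n) - w n = w' (Suc n) - w' n" using kstep kk by simp
  show ?case
  proof (cases "i = Suc n")
    case True
    then show ?thesis using end_eq by simp
  next
    case False
    \<comment> \<open>With rank and direction of the last step shared, its deletion alters both
      transforms in the same way, so the induction hypothesis applies to the shortened
      walks.\<close>
    have "rank_sum n w j = rank_sum n w' j" if "j \<le> n" for j
      using that kk eq'[of j] eq'[of "Suc j"] step_eq
      by (simp add: rank_sum_remove_last v_def k_def)
    moreover have "end_rank n w = end_rank n w'"
      using kk time_rank_last[of n w] time_rank_last[of n w'] by (simp add: k_def)
    ultimately show ?thesis using Suc.IH[OF un] Suc.prems(5) False by simp
  qed
qed

section \<open>The Vervaat transform as a rotation\<close>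

text \<open>The cyclic shift of the steps by k: the part of v after time k, followed by its initial
  part. For \<open>k \<le> n\<close> and \<open>v 0 = 0\<close> the two branches agree at the seam
  \<open>j = n - k\<close>.\<close>

definition rotate_walk :: "nat \<Rightarrow> nat \<Rightarrow> (nat \<Rightarrow> int) \<Rightarrow> nat \<Rightarrow> int" where
  "rotate_walk n k v =
    (\<lambda>j\<in>{0..n}. if j \<le> n - k then v (k + j) - v k else v n - v k + v (j - (n - k)))"

lemma rotate_walk_simple_walks:
  assumes "v \<in> simple_walks n" "k \<le> n"
  shows "rotate_walk n k v \<in> simple_walks n"
proof -
  have us: "unit_steps n v" and v0: "v 0 = 0"
    using assms by (auto simp: simple_walks_iff unit_steps_def)
  have "rotate_walk n k v (Suc t) = rotate_walk n k v t + 1 \<or>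
      rotate_walk n k v (Suc t) = rotate_walk n k v t - 1" if t: "t < n" for t
  proof -
    consider "Suc t \<le> n - k" | "t = n - k" | "n - k < t" by linarith
    then show ?thesis
    proof cases
      case 1
      then have "k + t < n" by simp
      then show ?thesis using 1 t us by (auto simp: rotate_walk_def unit_steps_def)
    next
      case 2
      then have "v (Suc 0) = v 0 + 1 \<or> v (Suc 0) = v 0 - 1" "Suc t - (n - k) = Suc 0" "k + t = n"
        using us t assms(2) by (auto simp: unit_steps_def)
      then show ?thesis using 2 t v0 by (auto simp: rotate_walk_def)
    next
      case 3
      then have "t - (n - k) < n" "Suc t - (n - k) = Suc (t - (n - k))" using t by auto
      then show ?thesis using 3 t us by (auto simp: rotate_walk_def unit_steps_def)
    qed
  qed
  then show ?thesis
    by (simp add: simple_walks_iff unit_steps_def) (simp add: rotate_walk_def)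
qed

lemma rotate_walk_inverse:
  assumes "v \<in> simple_walks n" "k \<le> n"
  shows "rotate_walk n (n - k) (rotate_walk n k v) = v"
proof
  fix j
  have v: "v \<in> extensional {0..n}" "v 0 = 0"
    using assms by (auto simp: simple_walks_iff unit_steps_def)
  show "rotate_walk n (n - k) (rotate_walk n k v) j = v j"
  proof (cases "j \<le> n")
    case True
    then show ?thesis
      \<comment> \<open>The two branches of the outer rotation split at k; \<open>j = 0\<close> and
        \<open>k = 0\<close> are the cases in which the inner rotation is evaluated on the other
        side of its seam.\<close>
      using assms(2) v(2) by (cases "j \<le> k"; cases "j = 0"; cases "k = 0") (auto simp: rotate_walk_def)
  next
    case False
    then show ?thesis using v by (simp add: rotate_walk_def extensional_def)
  qed
qed

lemma vervaat_time_props: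
  shows "vervaat_time n w \<le> n"
    and "i \<le> n \<Longrightarrow> w (vervaat_time n w) \<le> w i"
    and "i < vervaat_time n w \<Longrightarrow> w (vervaat_time n w) < w i"
proof -
  define A where "A = {j \<in> {0..n}. \<forall>i\<in>{0..n}. w j \<le> w i}"
  have "finite A" by (simp add: A_def)
  moreover have "A \<noteq> {}"
  proof -
    have "Min (w ` {0..n}) \<in> w ` {0..n}" by (rule Min_in) auto
    then obtain j where "Min (w ` {0..n}) = w j" "j \<in> {0..n}" by (rule imageE)
    then have "j \<in> A" by (auto simp: A_def simp flip: \<open>Min (w ` {0..n}) = w j\<close>)
    then show ?thesis by blast
  qed
  ultimately have "vervaat_time n w \<in> A" and le: "\<And>j. j \<in> A \<Longrightarrow> vervaat_time n w \<le> j"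
    unfolding vervaat_time_def A_def[symmetric] by auto
  then show 1: "vervaat_time n w \<le> n" and 2: "i \<le> n \<Longrightarrow> w (vervaat_time n w) \<le> w i" for i
    by (auto simp: A_def)
  assume i: "i < vervaat_time n w"
  show "w (vervaat_time n w) < w i"
  proof (rule ccontr)
    assume "\<not> w (vervaat_time n w) < w i"
    then have "i \<in> A" using 1 2 i by (force simp: A_def)
    then show False using le i by force
  qed
qed

lemma vervaat_time_eqI:
  assumes "k \<le> n" "\<And>i. i \<le> n \<Longrightarrow> w k \<le> w i" "\<And>i. i < k \<Longrightarrow> w k < w i"
  shows "vervaat_time n w = k"
  unfolding vervaat_time_def
proof (rule Min_eqI)
  fix j assume j: "j \<in> {j \<in> {0..n}. \<forall>i\<in>{0..n}. w j \<le> w i}"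
  show "k \<le> j"
  proof (rule ccontr)
    assume "\<not> k \<le> j"
    then have "w k < w j" using assms(3) by simp
    moreover have "w j \<le> w k" using j assms(1) by simp
    ultimately show False by simp
  qed
qed (use assms in auto)

lemma vervaat_transform_eq_rotate_walk:
  assumes "w \<in> simple_walks n"
  shows "vervaat_transform n w = rotate_walk n (vervaat_time n w) w"
proof
  fix j
  define \<tau> where "\<tau> = vervaat_time n w"
  have \<tau>: "\<tau> \<le> n" by (simp add: \<tau>_def vervaat_time_props)
  have w0: "w 0 = 0" using assms by (simp add: simple_walks_def)
  have "(\<Sum>i=1..j. increment w (vervaat_perm n w i)) = rotate_walk n \<tau> w j" if "j \<le> n"
    using that
  proof (induction j)
    case 0
    then show ?case using w0 by (simp add: rotate_walk_def)
  next
    case (Suc j)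
    have "increment w (vervaat_perm n w (Suc j)) = rotate_walk n \<tau> w (Suc j) - rotate_walk n \<tau> w j"
    proof (cases "Suc j \<le> n - \<tau>")
      case True
      then have "(j + \<tau>) mod n = j + \<tau>" by simp
      then have "vervaat_perm n w (Suc j) = Suc (\<tau> + j)"
        using Suc.prems by (simp add: vervaat_perm_def \<tau>_def)
      then show ?thesis using True Suc.prems by (simp add: rotate_walk_def increment_def)
    next
      case False
      \<comment> \<open>Beyond \<open>n - \<tau>\<close> the shifted index wraps around once and
        points into the initial part of w. The first such step starts at the seam, where
        \<open>w 0 = 0\<close> joins the branches.\<close>
      then have "j + \<tau> = n + (j - (n - \<tau>))" "j - (n - \<tau>) < n" using \<tau> Suc.prems by auto
      then have "(j + \<tau>) mod n = j - (n - \<tau>)" by (metis mod_add_self1 mod_less)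
      then have p: "vervaat_perm n w (Suc j) = Suc (j - (n - \<tau>))"
        using Suc.prems by (simp add: vervaat_perm_def \<tau>_def)
      have "Suc j - (n - \<tau>) = Suc (j - (n - \<tau>))" using False by auto
      then show ?thesis
        using False Suc.prems p w0 \<tau> by (cases "j = n - \<tau>") (auto simp: rotate_walk_def increment_def)
    qed
    then show ?case using Suc by simp
  qed
  then show "vervaat_transform n w j = rotate_walk n (vervaat_time n w) w j"
    by (cases "j \<le> n") (simp_all add: vervaat_transform_def \<tau>_def rotate_walk_def)
qed

text \<open>The conditions on a Vervaat pair (v, k) say that n - k is the first minimum of v rotated
  by k: non-negativity up to k bounds the times from n - k on, and the strict inequality with
  \<open>v n\<close> bounds the times before.\<close>

lemma bij_betw_vervaat:
  "bij_betw (\<lambda>w. (vervaat_transform n w, n - vervaat_time n w)) (simple_walks n)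
    {(v, k). vervaat_pair n v k}"
  (is "bij_betw ?g _ ?P")
proof (rule bij_betwI')
  fix w w' assume w: "w \<in> simple_walks n" and w': "w' \<in> simple_walks n"
  show "?g w = ?g w' \<longleftrightarrow> w = w'"
  proof
    assume "?g w = ?g w'"
    \<comment> \<open>The second component of the pair is exactly the shift that undoes the
      rotation.\<close>
    then have "rotate_walk n (n - vervaat_time n w) (rotate_walk n (vervaat_time n w) w) =
        rotate_walk n (n - vervaat_time n w') (rotate_walk n (vervaat_time n w') w')"
      by (simp add: vervaat_transform_eq_rotate_walk w w')
    then show "w = w'"
      by (simp add: rotate_walk_inverse w w' vervaat_time_props(1))
  qed simp
next
  fix w assume w: "w \<in> simple_walks n"
  define \<tau> where "\<tau> = vervaat_time n w"
  have \<tau>: "\<tau> \<le> n" "\<And>i. i \<le> n \<Longrightarrow> w \<tau> \<le> w i" "\<And>i. i < \<tau> \<Longrightarrow> w \<tau> < w i"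
    unfolding \<tau>_def using vervaat_time_props by blast+
  have w0: "w 0 = 0" using w by (simp add: simple_walks_def)
  have "rotate_walk n \<tau> w n = w n"
    using \<tau>(1) w0 by (cases "\<tau> = 0") (auto simp: rotate_walk_def)
  moreover have "rotate_walk n \<tau> w j \<ge> 0" if "j \<le> n - \<tau>" for j
  proof -
    have "\<tau> + j \<le> n" "j \<le> n" using that \<tau>(1) by auto
    then show ?thesis using that \<tau>(2)[of "\<tau> + j"] by (simp add: rotate_walk_def)
  qed
  moreover have "rotate_walk n \<tau> w j > w n" if "n - \<tau> \<le> j" "j < n" for j
    using that \<tau>(1) \<tau>(3)[of "j - (n - \<tau>)"] w0 by (cases "j = n - \<tau>") (auto simp: rotate_walk_def)
  ultimately show "?g w \<in> ?P"
    using rotate_walk_simple_walks[OF w \<tau>(1)]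
    by (simp add: vervaat_transform_eq_rotate_walk w \<tau>_def[symmetric] vervaat_pair_def)
next
  fix p assume "p \<in> ?P"
  then obtain v k where p: "p = (v, k)" and v: "v \<in> simple_walks n" and k: "k \<le> n"
    and nonneg: "\<And>j. j \<le> k \<Longrightarrow> v j \<ge> 0" and gt: "\<And>j. k \<le> j \<Longrightarrow> j < n \<Longrightarrow> v j > v n"
    by (auto simp: vervaat_pair_def)
  define w where "w = rotate_walk n k v"
  have w: "w \<in> simple_walks n" unfolding w_def by (rule rotate_walk_simple_walks[OF v k])
  have wk: "w (n - k) = v n - v k" using k by (simp add: w_def rotate_walk_def)
  have lt: "w (n - k) < w i" if "i < n - k" for i
  proof -
    have "k + i < n" "i \<le> n" using that by auto
    then show ?thesis using that gt[of "k + i"] unfolding wk by (simp add: w_def rotate_walk_def)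
  qed
  have time: "vervaat_time n w = n - k"
  proof (rule vervaat_time_eqI)
    fix i assume i: "i \<le> n"
    consider "i < n - k" | "i = n - k" | "n - k < i" by linarith
    then show "w (n - k) \<le> w i"
    proof cases
      case 3
      then show ?thesis
        using i nonneg[of "i - (n - k)"] unfolding wk by (simp add: w_def rotate_walk_def)
    qed (use lt in \<open>auto simp: less_imp_le\<close>)
  qed (use lt in auto)
  have "?g w = p"
    using rotate_walk_inverse[OF v k] k
    by (simp add: vervaat_transform_eq_rotate_walk w time p) (simp add: w_def)
  then show "\<exists>w\<in>simple_walks n. p = ?g w" using w by blast
qed

section \<open>The bijection for the quantile transform and the counting of fibres\<close>

lemma bij_betw_quantile:
  "bij_betw (\<lambda>w. (quantile_transform n w, end_rank n w)) (simple_walks n)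
    {(v, k). vervaat_pair n v k}"
  (is "bij_betw ?f _ ?P")
proof -
  have inj: "inj_on ?f (simple_walks n)"
  proof (rule inj_onI)
    fix w w' assume w: "w \<in> simple_walks n" "w' \<in> simple_walks n" and eq: "?f w = ?f w'"
    have us: "unit_steps n w" "unit_steps n w'" using w by (auto simp: simple_walks_iff)
    have "rank_sum n w j = rank_sum n w' j" if "j \<le> n" for j
      using eq that by (simp flip: rank_sum_quantile_transform)
    then have "w i = w' i" if "i \<le> n" for i
      using unit_steps_eq_if_rank_sum_eq[OF us] eq that by blast
    then show "w = w'"
      using w by (intro extensionalityI[of _ "{0..n}"]) (auto simp: simple_walks_iff)
  qed
  have "?f ` simple_walks n = ?P"
  proof (rule card_subset_eq)
    show "finite ?P"
      using bij_betw_finite[OF bij_betw_vervaat] finite_simple_walks by blast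
    show "?f ` simple_walks n \<subseteq> ?P" using vervaat_pair_quantile_transform by auto
    show "card (?f ` simple_walks n) = card ?P"
      using card_image[OF inj] bij_betw_same_card[OF bij_betw_vervaat[of n]] by simp
  qed
  then show ?thesis using inj by (simp add: bij_betw_def)
qed

text \<open>The right side involves only P, so two maps that lift to bijections from A onto the same
  P have fibres of equal size.\<close>

lemma card_fst_fibre:
  assumes "bij_betw (\<lambda>x. (f x, g x)) A P"
  shows "card {x \<in> A. f x = a} = card {p \<in> P. fst p = a}"
proof -
  have "(\<lambda>x. (f x, g x)) ` {x \<in> A. f x = a} = {p \<in> P. fst p = a}"
    using assms by (auto simp: bij_betw_def)
  then have "bij_betw (\<lambda>x. (f x, g x)) {x \<in> A. f x = a} {p \<in> P. fst p = a}"
    by (intro bij_betw_subset[OF assms]) auto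
  then show ?thesis by (rule bij_betw_same_card)
qed

section \<open>Quantile pairs and Vervaat pairs\<close>

text \<open>A non-negative end rules out the first-passage case, so v is non-negative throughout.
  Conversely, a Vervaat pair has \<open>v j \<ge> 0\<close> up to k, and beyond k the values exceed
  \<open>v n \<ge> 0\<close>.\<close>

lemma quantile_pair_iff_nonneg:
  assumes v: "v \<in> simple_walks n" and k: "k \<in> {1..n}" and "v n \<ge> 0"
  shows "quantile_pair n v k \<longleftrightarrow> vervaat_pair n v k"
proof
  assume q: "quantile_pair n v k"
  then have "\<forall>j\<in>{0..n}. v j \<ge> 0"
    using assms by (auto simp: quantile_pair_def quantile_walk_def first_passage_bridge_neg_def)
  then show "vervaat_pair n v k" using q v by (auto simp: quantile_pair_def vervaat_pair_def)
next
  assume V: "vervaat_pair n v k"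
  have "v j \<ge> 0" if j: "j \<le> n" for j
  proof -
    consider "j \<le> k" | "k \<le> j" "j < n" | "j = n" using j by linarith
    then show ?thesis
    proof cases
      case 2
      then have "v j > v n" using V by (simp add: vervaat_pair_def)
      then show ?thesis using assms by simp
    qed (use V assms in \<open>simp_all add: vervaat_pair_def\<close>)
  qed
  then show "quantile_pair n v k"
    using V v k by (auto simp: quantile_pair_def quantile_walk_def vervaat_pair_def)
qed

text \<open>The half-open range below k of a quantile pair is the closed range up to k - 1 of a
  Vervaat pair. In both cases v stays above \<open>v n\<close> before n: a first-passage bridge
  starts above \<open>v n\<close> and cannot cross it, and a value that is at least 0 exceeds
  \<open>v n\<close>.\<close>

lemma quantile_pair_iff_neg:
  assumes v: "v \<in> simple_walks n" and k: "k \<in> {1..n}" and neg: "v n < 0"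
  shows "quantile_pair n v k \<longleftrightarrow> vervaat_pair n v (k - 1)"
proof
  assume q: "quantile_pair n v k"
  then have "first_passage_bridge_neg n v"
    using neg unfolding quantile_pair_def quantile_walk_def
    by (meson atLeastAtMost_iff le0 not_le order_refl)
  then have fpb: "v j \<noteq> v n" if "j < n" for j
    using that by (simp add: first_passage_bridge_neg_def)
  have us: "unit_steps n v" using v by (simp add: simple_walks_iff)
  have "v j > v n" if j: "j < n" for j
  proof (rule ccontr)
    \<comment> \<open>Starting from 0, the walk can get below \<open>v n\<close> by time j only by
      leaving level \<open>v n\<close> earlier, against first passage.\<close>
    assume "\<not> v j > v n"
    then have "v j < v n" using fpb[OF j] by simp
    moreover have "unit_steps j v" using us by (rule unit_steps_mono) (use j in simp)
    moreover have "v n \<le> v 0" using neg us by (simp add: unit_steps_def)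
    ultimately obtain t where "t < j" "v t = v n" using descent[of j v 0 "v n"] by auto
    then show False using fpb[of t] j by simp
  qed
  then show "vervaat_pair n v (k - 1)"
    using q v k by (auto simp: quantile_pair_def vervaat_pair_def)
next
  assume V: "vervaat_pair n v (k - 1)"
  have nonneg: "v j \<ge> 0" if "j < k" for j
    using V that by (auto simp: vervaat_pair_def)
  have gt: "v j > v n" if "j < n" for j
  proof (cases "j < k")
    case True
    then show ?thesis using nonneg[of j] neg by simp
  next
    case False
    then show ?thesis using V that by (simp add: vervaat_pair_def)
  qed
  then have "first_passage_bridge_neg n v"
    using neg by (fastforce simp: first_passage_bridge_neg_def)
  then show "quantile_pair n v k"
    using nonneg gt v k by (simp add: quantile_pair_def quantile_walk_def)
qed

theorem corollary7p4:
  fixes n :: nat and v :: "nat \<Rightarrow> int"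
  assumes "n \<ge> 1" and "v \<in> simple_walks n"
  shows "(\<forall>k\<in>{1..n}.
            (v n \<ge> 0 \<longrightarrow> (quantile_pair n v k \<longleftrightarrow> vervaat_pair n v k)) \<and>
            (v n < 0 \<longrightarrow> (quantile_pair n v k \<longleftrightarrow> vervaat_pair n v (k - 1)))) \<and>
         card {w \<in> simple_walks n. vervaat_transform n w = v} =
         card {w \<in> simple_walks n. quantile_transform n w = v}"
  using quantile_pair_iff_nonneg[OF assms(2)] quantile_pair_iff_neg[OF assms(2)]
    card_fst_fibre[OF bij_betw_vervaat] card_fst_fibre[OF bij_betw_quantile]
  by simp

end
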